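(* Let $\left(\vec X^{m+1},\vec\chi^{m+1},\mu^{m+1},\kappa^{m+1}\right)$, $m\ge 0$, be a solution of the VC-MD-BDF1 method, i.e. of the following fully discrete scheme: given $\mathcal S^m=\vec X^m(\mathcal S^0)$, find $(\vec X^{m+1},\vec\chi^{m+1},\mu^{m+1},\kappa^{m+1})\in[\mathbb K(\mathcal S^0)]^3\times[\mathbb K(\mathcal S^m)]^3\times\mathbb K(\mathcal S^m)\times\mathbb K(\mathcal S^m)$ such that $$\Big(\tfrac{\vec\chi^{m+1}-\vec{\mathrm{id}}}{\Delta t}\cdot\vec n^{m+\frac12},\varphi\Big)^h_{\mathcal S^m}+(\nabla_{\mathcal S}\mu^{m+1},\nabla_{\mathcal S}\varphi)^h_{\mathcal S^m}=0\quad\forall\varphi\in\mathbb K(\mathcal S^m),$$ $$(\mu^{m+1},\phi)^h_{\mathcal S^m}-\big(\mathbf Z(\vec n^m)\nabla_{\mathcal S}\vec\chi^{m+1},\nabla_{\mathcal S}(\vec v^m\phi)\big)^h_{\mathcal S^m}=0\quad\forall\phi\in\mathbb K(\mathcal S^m),$$ $$\Big(\kappa^{m+1},\vec v^m\cdot\vec\omega\sqrt{\det\mathbf J^m}\Big)^h_{\mathcal S^m}+\Big(\nabla_{\mathcal S}\vec\chi^{m+1}(\mathbf J^m)^{-1},\nabla_{\mathcal S}\vec\omega\sqrt{\det\mathbf J^m}\Big)^h_{\mathcal S^m}=0\quad\forall\vec\omega\in[\mathbb K(\mathcal S^m)]^3,$$ $$\vec X^{m+1}=\vec\chi^{m+1}\circ\vec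 X^m .$$ Then the scheme is volume-conservative: $V(\vec X^{m+1})=V(\vec X^m)$ for all $m\ge0$.
   Context: Triangulated surfaces. All discrete surfaces are closed, oriented polygonal surfaces in $\mathbb R^3$ with the same connectivity as the initial one $\mathcal S^0$. Such a surface $\mathcal S=\bigcup_{l=1}^L\overline\sigma_l$ consists of $L$ mutually disjoint non-degenerate triangles $\sigma_l=\Delta\{\vec q_{l_1},\vec q_{l_2},\vec q_{l_3}\}$ (vertices ordered anticlockwise), with $\mathscr T\{\sigma_l\}=(\vec q_{l_2}-\vec q_{l_1})\times(\vec q_{l_3}-\vec q_{l_1})$, area $|\sigma_l|=\frac12|\mathscr T\{\sigma_l\}|$ and unit outward normal $\vec n_l=\mathscr T\{\sigma_l\}/|\mathscr T\{\sigma_l\}|$ ($\vec n$ is the piecewise constant function with values $\vec n_l$). Superscripts $m$ denote quantities on $\mathcal S^m$, the surface at time $t_m=m\Delta t$, $\Delta t>0$, parametrized by the piecewise linear map $\vec X^m:\mathcal S^0\to\mathcal S^m$. $\vec{\mathrm{id}}$ is the identity function on the surface. $\mathbb K(\mathcal S)$ is the space of continuous functions on $\mathcal S$ that are affine on each triangle. $\nabla_{\mathcal S}$ is the elementwise surface (tangential) gradient; for a vector function $\nabla_{\mathcal S}\vec f=(\nabla_{\mathcal S}f_1,\nabla_{\mathcal S}f_2,\nabla_{\mathcal S}f_3)^T$. The mass-lumped inner product is $(f,g)^h_{\mathcal S}=\frac13\sum_{l=1}^L\sum_{i=1}^3|\sigma_l|\,f((\vec q_{l_i})^-)\,g((\vec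 q_{l_i})^-)$, where $f((\vec q_{l_i})^-)$ is the one-sided limit at $\vec q_{l_i}$ from inside $\sigma_l$; for vector or matrix arguments the product is the Euclidean or Frobenius inner product. The averaged normal $\vec v\in[\mathbb K(\mathcal S)]^3$ has value at the vertex $\vec q_k$ equal to the normalization to unit length of $\sum_{\sigma_l:\,\vec q_k\in\overline\sigma_l}|\sigma_l|\vec n_l$. The time-weighted normal is the piecewise constant vector on $\mathcal S^m$ with $$\vec n_l^{m+\frac12}=\frac{\mathscr T\{\sigma_l^m\}+4\mathscr T\{\sigma_l^{m+\frac12}\}+\mathscr T\{\sigma_l^{m+1}\}}{6|\mathscr T\{\sigma_l^m\}|},$$ where $\sigma_l^{m+1}$ is the triangle of $\mathcal S^{m+1}$ corresponding to $\sigma_l^m$ and $\sigma_l^{m+\frac12}$ is the triangle with vertices $\frac12(\vec q^m_{l_i}+\vec q^{m+1}_{l_i})$. Anisotropy: $\gamma:\mathbb S^2\to(0,\infty)$ is the surface energy density, extended to $\mathbb R^3$ by $\gamma(\vec p)=|\vec p|\gamma(\vec p/|\vec p|)$ for $\vec p\ne0$ and $\gamma(0)=0$; $\vec\xi(\vec n)=\nabla\gamma(\vec p)|_{\vec p=\vec n}$; $\mathbf Z(\vec n)=\gamma(\vec n)\mathbf I-\vec n\vec\xi^T-\vec\xi\vec n^T+s(\vec n)\vec n\vec n^T$, with $s$ a stability function making $\mathbf Z$ positive definite. $\mathbf J^m=\nabla_{\mathcal S^m}\vec Y^0(\nabla_{\mathcal S^m}\vec Y^0)^T+\vec n^m(\vec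 n^m)^T$ elementwise, where $\vec Y^0\in[\mathbb K(\mathcal S^m)]^3$ takes at each vertex of $\mathcal S^m$ the value of the corresponding vertex of $\mathcal S^0$. Discrete enclosed volume: $V(\vec X^m)=\frac19\sum_{l=1}^L\sum_{i=1}^3|\sigma_l^m|\,\vec q^m_{l_i}\cdot\vec n^m_l$. *)

theory Defs
  imports "HOL-Analysis.Analysis"
begin

unbundle cross3_syntax

section \<open>Triangulated surfaces\<close>

text \<open>The connectivity is a map \<^term>\<open>tri\<close> with \<^term>\<open>tri l i\<close> the index of the
  \<open>i\<close>-th vertex of triangle \<open>l\<close>, and \<^term>\<open>q k\<close> is the position of vertex \<open>k\<close>.  The finite
  types \<open>'l\<close> and \<open>'v\<close> index the triangles and the vertices.  In type \<open>3\<close> the successor is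
  cyclic, \<open>3 + 1 = 1\<close>, so \<open>(tri l i, tri l (i + 1))\<close> runs through the directed edges of
  triangle \<open>l\<close>.\<close>

type_synonym ('l, 'v) connectivity = "'l \<Rightarrow> 3 \<Rightarrow> 'v"

definition tri_vector :: "('l, 'v) connectivity \<Rightarrow> ('v \<Rightarrow> real^3) \<Rightarrow> 'l \<Rightarrow> real^3" where
  "tri_vector tri q l = (q (tri l 2) - q (tri l 1)) \<times> (q (tri l 3) - q (tri l 1))"

definition tri_area :: "('l, 'v) connectivity \<Rightarrow> ('v \<Rightarrow> real^3) \<Rightarrow> 'l \<Rightarrow> real" where
  "tri_area tri q l = norm (tri_vector tri q l) / 2"

definition tri_normal :: "('l, 'v) connectivity \<Rightarrow> ('v \<Rightarrow> real^3) \<Rightarrow> 'l \<Rightarrow> real^3" where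
  "tri_normal tri q l = tri_vector tri q l /\<^sub>R norm (tri_vector tri q l)"

definition closed_tri :: "('l, 'v) connectivity \<Rightarrow> ('v \<Rightarrow> real^3) \<Rightarrow> 'l \<Rightarrow> (real^3) set" where
  "closed_tri tri q l = convex hull {q (tri l 1), q (tri l 2), q (tri l 3)}"

definition open_tri :: "('l, 'v) connectivity \<Rightarrow> ('v \<Rightarrow> real^3) \<Rightarrow> 'l \<Rightarrow> (real^3) set" where
  "open_tri tri q l = rel_interior (closed_tri tri q l)"

definition surface :: "('l, 'v) connectivity \<Rightarrow> ('v \<Rightarrow> real^3) \<Rightarrow> (real^3) set" where
  "surface tri q = (\<Union>l. closed_tri tri q l)"

text \<open>The triangles form a conforming triangulation, with vertex indices all used;
  each directed edge has exactly one oppositely directed partner.\<close>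

definition triangulation :: "('l, 'v) connectivity \<Rightarrow> ('v \<Rightarrow> real^3) \<Rightarrow> bool" where
  "triangulation tri q \<longleftrightarrow>
     (\<forall>l. tri_vector tri q l \<noteq> 0) \<and>
     (\<forall>l l'. l \<noteq> l' \<longrightarrow> open_tri tri q l \<inter> open_tri tri q l' = {}) \<and>
     (\<forall>l l'. closed_tri tri q l \<inter> closed_tri tri q l'
              = convex hull (q ` (range (tri l) \<inter> range (tri l')))) \<and>
     (\<forall>k. \<exists>l i. tri l i = k)"

definition closed_oriented :: "('l, 'v) connectivity \<Rightarrow> bool" where
  "closed_oriented tri \<longleftrightarrow>
     (\<forall>l i. \<exists>!e. tri (fst e) (snd e) = tri l (i + 1) \<and> tri (fst e) (snd e + 1) = tri l i)"

definition locally_planar :: "(real^3) set \<Rightarrow> bool" where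
  "locally_planar S \<longleftrightarrow>
     (\<forall>x\<in>S. \<exists>U W :: _ set. openin (top_of_set S) U \<and> x \<in> U \<and>
              open (W :: (real^2) set) \<and> U homeomorphic W)"

text \<open>The normals are outward with respect to the bounded region enclosed by the surface.
  The region is not taken to be \<^const>\<open>inside\<close> of the surface because a disconnected closed
  surface may have nested components.\<close>

definition outward_oriented :: "('l, 'v) connectivity \<Rightarrow> ('v \<Rightarrow> real^3) \<Rightarrow> bool" where
  "outward_oriented tri q \<longleftrightarrow>
     (\<exists>\<Omega>. open \<Omega> \<and> bounded \<Omega> \<and> frontier \<Omega> = surface tri q \<and>
        (\<forall>l. \<forall>x\<in>open_tri tri q l. \<forall>\<^sub>F \<epsilon> in at_right 0.
            x - \<epsilon> *\<^sub>R tri_normal tri q l \<in> \<Omega> \<and>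
            x + \<epsilon> *\<^sub>R tri_normal tri q l \<notin> closure \<Omega>))"

definition discrete_surface :: "('l, 'v) connectivity \<Rightarrow> ('v \<Rightarrow> real^3) \<Rightarrow> bool" where
  "discrete_surface tri q \<longleftrightarrow>
     triangulation tri q \<and> closed_oriented tri \<and>
     locally_planar (surface tri q) \<and> outward_oriented tri q"

definition enclosed_volume :: "('l::finite, 'v) connectivity \<Rightarrow> ('v \<Rightarrow> real^3) \<Rightarrow> real" where
  "enclosed_volume tri q =
     (1/9) * (\<Sum>l\<in>UNIV. \<Sum>i\<in>UNIV. tri_area tri q l * (q (tri l i) \<bullet> tri_normal tri q l))"

section \<open>Functions on a surface\<close>

text \<open>Functions on the surface are total functions on \<open>real^3\<close>; only their values on the
  surface matter, and for elementwise defined ones only those on the open triangles.\<close>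

definition K_space :: "('l, 'v) connectivity \<Rightarrow> ('v \<Rightarrow> real^3) \<Rightarrow> (real^3 \<Rightarrow> real) set" where
  "K_space tri q =
     {f. continuous_on (surface tri q) f \<and>
         (\<forall>l. \<exists>a b. \<forall>x\<in>closed_tri tri q l. f x = a \<bullet> x + b)}"

definition K_space3 ::
  "('l, 'v) connectivity \<Rightarrow> ('v \<Rightarrow> real^3) \<Rightarrow> (real^3 \<Rightarrow> real^3) set" where
  "K_space3 tri q = {f. \<forall>i. (\<lambda>x. f x $ i) \<in> K_space tri q}"

text \<open>The element of \<^const>\<open>K_space3\<close> with given vertex values; the value \<open>0\<close> off the surface
  makes it unique as a total function.\<close>

definition nodal_function ::
  "('l, 'v) connectivity \<Rightarrow> ('v \<Rightarrow> real^3) \<Rightarrow> ('v \<Rightarrow> real^3) \<Rightarrow> real^3 \<Rightarrow> real^3" where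
  "nodal_function tri q w =
     (THE f. f \<in> K_space3 tri q \<and> (\<forall>k. f (q k) = w k) \<and> (\<forall>x. x \<notin> surface tri q \<longrightarrow> f x = 0))"

definition pw_const ::
  "('l, 'v) connectivity \<Rightarrow> ('v \<Rightarrow> real^3) \<Rightarrow> ('l \<Rightarrow> 'a) \<Rightarrow> real^3 \<Rightarrow> 'a" where
  "pw_const tri q c x = c (THE l. x \<in> open_tri tri q l)"

definition normal_field :: "('l, 'v) connectivity \<Rightarrow> ('v \<Rightarrow> real^3) \<Rightarrow> real^3 \<Rightarrow> real^3" where
  "normal_field tri q = pw_const tri q (tri_normal tri q)"

definition surf_grad ::
  "('l, 'v) connectivity \<Rightarrow> ('v \<Rightarrow> real^3) \<Rightarrow> (real^3 \<Rightarrow> real) \<Rightarrow> real^3 \<Rightarrow> real^3" where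
  "surf_grad tri q f x =
     (THE g. \<exists>l. x \<in> open_tri tri q l \<and> g \<bullet> tri_normal tri q l = 0 \<and>
                 (f has_derivative (\<lambda>h. g \<bullet> h)) (at x within open_tri tri q l))"

definition surf_grad3 ::
  "('l, 'v) connectivity \<Rightarrow> ('v \<Rightarrow> real^3) \<Rightarrow> (real^3 \<Rightarrow> real^3) \<Rightarrow> real^3 \<Rightarrow> real^3^3" where
  "surf_grad3 tri q f x = (\<chi> i. surf_grad tri q (\<lambda>y. f y $ i) x)"

definition vertex_limit ::
  "('l, 'v) connectivity \<Rightarrow> ('v \<Rightarrow> real^3) \<Rightarrow> (real^3 \<Rightarrow> 'a::t2_space) \<Rightarrow> 'l \<Rightarrow> 3 \<Rightarrow> 'a" where
  "vertex_limit tri q f l i = Lim (at (q (tri l i)) within open_tri tri q l) f"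

text \<open>The inner product of \<open>real^3^3\<close> is the Frobenius one.\<close>

definition lumped ::
  "('l::finite, 'v) connectivity \<Rightarrow> ('v \<Rightarrow> real^3) \<Rightarrow>
     (real^3 \<Rightarrow> 'a::real_inner) \<Rightarrow> (real^3 \<Rightarrow> 'a) \<Rightarrow> real" where
  "lumped tri q f g =
     (1/3) * (\<Sum>l\<in>UNIV. \<Sum>i\<in>UNIV.
        tri_area tri q l * (vertex_limit tri q f l i \<bullet> vertex_limit tri q g l i))"

text \<open>\<^const>\<open>sgn\<close> is normalization to unit length.\<close>

definition averaged_normal ::
  "('l::finite, 'v) connectivity \<Rightarrow> ('v \<Rightarrow> real^3) \<Rightarrow> real^3 \<Rightarrow> real^3" where
  "averaged_normal tri q =
     nodal_function tri q
       (\<lambda>k. sgn (\<Sum>l \<in> {l. q k \<in> closed_tri tri q l}. tri_area tri q l *\<^sub>R tri_normal tri q l))"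

definition half_normal ::
  "('l, 'v) connectivity \<Rightarrow> ('v \<Rightarrow> real^3) \<Rightarrow> ('v \<Rightarrow> real^3) \<Rightarrow> real^3 \<Rightarrow> real^3" where
  "half_normal tri q q' =
     pw_const tri q (\<lambda>l.
       (tri_vector tri q l + 4 *\<^sub>R tri_vector tri (\<lambda>k. (1/2) *\<^sub>R (q k + q' k)) l
          + tri_vector tri q' l) /\<^sub>R (6 * norm (tri_vector tri q l)))"

section \<open>Anisotropy and the metric term\<close>

definition outer :: "real^3 \<Rightarrow> real^3 \<Rightarrow> real^3^3" where
  "outer a b = (\<chi> i j. a $ i * b $ j)"

definition aniso_ext :: "(real^3 \<Rightarrow> real) \<Rightarrow> real^3 \<Rightarrow> real" where
  "aniso_ext \<gamma> p = (if p = 0 then 0 else norm p * \<gamma> (p /\<^sub>R norm p))"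

definition xi_vector :: "(real^3 \<Rightarrow> real) \<Rightarrow> real^3 \<Rightarrow> real^3" where
  "xi_vector \<gamma> n = (THE D. GDERIV (aniso_ext \<gamma>) n :> D)"

definition Z_matrix :: "(real^3 \<Rightarrow> real) \<Rightarrow> (real^3 \<Rightarrow> real) \<Rightarrow> real^3 \<Rightarrow> real^3^3" where
  "Z_matrix \<gamma> s n =
     \<gamma> n *\<^sub>R mat 1 - outer n (xi_vector \<gamma> n) - outer (xi_vector \<gamma> n) n + s n *\<^sub>R outer n n"

text \<open>Only the values of \<open>\<gamma>\<close> and \<open>s\<close> on the unit sphere are used.  \<^const>\<open>Z_matrix\<close> is symmetric
  by construction, so positive definiteness is positivity of its quadratic form.\<close>

definition anisotropy :: "(real^3 \<Rightarrow> real) \<Rightarrow> (real^3 \<Rightarrow> real) \<Rightarrow> bool" where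
  "anisotropy \<gamma> s \<longleftrightarrow>
     (\<forall>n\<in>sphere 0 1. \<gamma> n > 0 \<and> aniso_ext \<gamma> differentiable (at n) \<and>
        (\<forall>w. w \<noteq> 0 \<longrightarrow> w \<bullet> (Z_matrix \<gamma> s n *v w) > 0))"

definition J_matrix ::
  "('l, 'v) connectivity \<Rightarrow> ('v \<Rightarrow> real^3) \<Rightarrow> ('v \<Rightarrow> real^3) \<Rightarrow> real^3 \<Rightarrow> real^3^3" where
  "J_matrix tri q0 q x =
     (let G = surf_grad3 tri q (nodal_function tri q q0) x; n = normal_field tri q x
      in G ** transpose G + outer n n)"

section \<open>One time step of the scheme\<close>

text \<open>\<open>X\<close> and \<open>X'\<close> are the parametrizations over the initial surface (with vertices \<open>q0\<close>) at
  the old and the new time level.\<close>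

definition VC_MD_BDF1_step ::
  "real \<Rightarrow> (real^3 \<Rightarrow> real) \<Rightarrow> (real^3 \<Rightarrow> real) \<Rightarrow>
   ('l::finite, 'v) connectivity \<Rightarrow> ('v \<Rightarrow> real^3) \<Rightarrow>
   (real^3 \<Rightarrow> real^3) \<Rightarrow> (real^3 \<Rightarrow> real^3) \<Rightarrow>
   (real^3 \<Rightarrow> real^3) \<Rightarrow> (real^3 \<Rightarrow> real) \<Rightarrow> (real^3 \<Rightarrow> real) \<Rightarrow> bool" where
  "VC_MD_BDF1_step \<Delta>t \<gamma> s tri q0 X X' chi \<mu> \<kappa> \<longleftrightarrow>
     (let q = (\<lambda>k. X (q0 k)); q' = (\<lambda>k. X' (q0 k));
          n = normal_field tri q; v = averaged_normal tri q; J = J_matrix tri q0 q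
      in X' \<in> K_space3 tri q0 \<and> chi \<in> K_space3 tri q \<and>
         \<mu> \<in> K_space tri q \<and> \<kappa> \<in> K_space tri q \<and>
         (\<forall>\<phi>\<in>K_space tri q.
            lumped tri q (\<lambda>x. ((chi x - x) /\<^sub>R \<Delta>t) \<bullet> half_normal tri q q' x) \<phi>
            + lumped tri q (surf_grad tri q \<mu>) (surf_grad tri q \<phi>) = 0) \<and>
         (\<forall>\<phi>\<in>K_space tri q.
            lumped tri q \<mu> \<phi>
            - lumped tri q (\<lambda>x. Z_matrix \<gamma> s (n x) ** surf_grad3 tri q chi x)
                           (surf_grad3 tri q (\<lambda>x. \<phi> x *\<^sub>R v x)) = 0) \<and>
         (\<forall>\<omega>\<in>K_space3 tri q.
            lumped tri q \<kappa> (\<lambda>x. (v x \<bullet> \<omega> x) * sqrt (det (J x)))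
            + lumped tri q (\<lambda>x. surf_grad3 tri q chi x ** matrix_inv (J x))
                           (\<lambda>x. sqrt (det (J x)) *\<^sub>R surf_grad3 tri q \<omega> x) = 0) \<and>
         (\<forall>x\<in>surface tri q0. X' x = chi (X x)))"

end

theory Submission
  imports Defs
begin

text \<open>Move each vertex along the segment \<open>q(t) = q + t (q' - q)\<close>, with displacement
  \<open>d = q' - q\<close>.  Six times the enclosed volume is \<open>\<Sum>\<^sub>l det (q\<^sub>1, q\<^sub>2, q\<^sub>3)\<close>, a cubic in \<open>t\<close>.
  In its rate of change each vertex contributes \<open>d\<^sub>i\<close> paired with the cross product of the
  opposite edge, whereas the scheme pairs \<open>d\<^sub>1 + d\<^sub>2 + d\<^sub>3\<close> with the whole triangle vector
  \<open>q\<^sub>1 \<times> q\<^sub>2 + q\<^sub>2 \<times> q\<^sub>3 + q\<^sub>3 \<times> q\<^sub>1\<close>.  The discrepancy is a sum over directed edges of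
  \<open>(d\<^sub>a + d\<^sub>b) \<bullet> (q\<^sub>a \<times> q\<^sub>b)\<close>, which changes sign with the direction of the edge and so cancels
  over a closed oriented surface.  The rate of change is quadratic in \<open>t\<close>, so Simpson's rule
  with weights \<open>1, 4, 1\<close> integrates it exactly; this is where the time-weighted normal comes from.
  Hence the volume increment is a multiple of the mass-lumped product of
  \<open>chi - id\<close> with the time-weighted normal (\<open>volume_increment\<close>).

  The first equation of the scheme, tested with constants, says that this product vanishes.
  What remains is to evaluate the lumped product, where the one-sided limits at the vertices
  exist and are the nodal values because an open triangle accumulates at each of its
  corners (\<open>vertex_limit_eqI\<close>).\<close>

section \<open>Volume increment of a closed oriented surface\<close>

text \<open>Closedness and orientation make edge reversal an involution of the set of directed
  edges, and reindexing by it negates the sum.\<close>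

lemma sum_directed_edges_antisym:
  fixes tri :: "('l::finite, 'v) connectivity" and F :: "'v \<Rightarrow> 'v \<Rightarrow> real"
  assumes closed: "closed_oriented tri" and antisym: "\<And>a b. F b a = - F a b"
  shows "(\<Sum>l\<in>UNIV. \<Sum>i\<in>UNIV. F (tri l i) (tri l (i + 1))) = 0"
proof -
  let ?opp = "\<lambda>e e'. tri (fst e') (snd e') = tri (fst e) (snd e + 1) \<and>
                     tri (fst e') (snd e' + 1) = tri (fst e) (snd e)"
  define opposite where "opposite e = (THE e'. ?opp e e')" for e
  have ex1: "\<exists>!e'. ?opp e e'" for e
    using closed unfolding closed_oriented_def by blast
  have opp: "?opp e (opposite e)" for e
    unfolding opposite_def by (rule theI'[OF ex1])
  have "opposite (opposite e) = e" for e
    unfolding opposite_def[of "opposite e"] by (rule the1_equality[OF ex1]) (use opp[of e] in simp)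
  then have "bij opposite"
    by (rule involuntory_imp_bij)
  define S where "S = (\<Sum>e\<in>UNIV. F (tri (fst e) (snd e)) (tri (fst e) (snd e + 1)))"
  have "S = (\<Sum>e\<in>UNIV. F (tri (fst (opposite e)) (snd (opposite e)))
                       (tri (fst (opposite e)) (snd (opposite e) + 1)))"
    unfolding S_def by (rule sum.reindex_bij_betw[OF \<open>bij opposite\<close>, symmetric])
  also have "\<dots> = (\<Sum>e\<in>UNIV. - F (tri (fst e) (snd e)) (tri (fst e) (snd e + 1)))"
  proof (rule sum.cong)
    fix e :: "'l \<times> 3"
    show "F (tri (fst (opposite e)) (snd (opposite e))) (tri (fst (opposite e)) (snd (opposite e) + 1))
        = - F (tri (fst e) (snd e)) (tri (fst e) (snd e + 1))"
      unfolding opp[THEN conjunct1] opp[THEN conjunct2] by (rule antisym)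
  qed simp
  also have "\<dots> = - S"
    by (simp add: S_def sum_negf)
  finally have "S = 0"
    by simp
  then show ?thesis
    by (simp add: S_def sum.cartesian_product UNIV_Times_UNIV[symmetric] case_prod_unfold
        del: UNIV_Times_UNIV)
qed

text \<open>Simpson's rule for the edge discrepancy \<open>(d\<^sub>a + d\<^sub>b) \<bullet> (q\<^sub>a \<times> q\<^sub>b)\<close>, up to the factor \<open>1/6\<close>.\<close>

definition edge_flux :: "('v \<Rightarrow> real^3) \<Rightarrow> ('v \<Rightarrow> real^3) \<Rightarrow> 'v \<Rightarrow> 'v \<Rightarrow> real" where
  "edge_flux q q' a b =
     ((q' a - q a) + (q' b - q b)) \<bullet>
       (q a \<times> q b + (q a + q' a) \<times> (q b + q' b) + q' a \<times> q' b)"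

lemma edge_flux_antisym: "edge_flux q q' b a = - edge_flux q q' a b"
proof -
  have "q b \<times> q a + (q b + q' b) \<times> (q a + q' a) + q' b \<times> q' a
      = - (q a \<times> q b + (q a + q' a) \<times> (q b + q' b) + q' a \<times> q' b)"
    by (subst (1 2 3) cross_skew) simp
  then show ?thesis
    unfolding edge_flux_def by (simp only: inner_minus_right) (simp add: add.commute)
qed

definition simpson_vector ::
  "('l, 'v) connectivity \<Rightarrow> ('v \<Rightarrow> real^3) \<Rightarrow> ('v \<Rightarrow> real^3) \<Rightarrow> 'l \<Rightarrow> real^3" where
  "simpson_vector tri q q' l =
     tri_vector tri q l + 4 *\<^sub>R tri_vector tri (\<lambda>k. (1/2) *\<^sub>R (q k + q' k)) l + tri_vector tri q' l"

lemma tri_vector_cyclic: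
  "tri_vector tri q l =
     q (tri l 1) \<times> q (tri l 2) + q (tri l 2) \<times> q (tri l 3) + q (tri l 3) \<times> q (tri l 1)"
  by (simp add: tri_vector_def vec_eq_iff forall_3 cross3_def algebra_simps)

lemma simpson_vector_eq:
  "simpson_vector tri q q' l =
     tri_vector tri q l + tri_vector tri (\<lambda>k. q k + q' k) l + tri_vector tri q' l"
proof -
  have "4 *\<^sub>R tri_vector tri (\<lambda>k. (1/2) *\<^sub>R p k) l = tri_vector tri p l" for p
    by (simp add: tri_vector_cyclic cross_mult_left cross_mult_right scaleR_add_right)
  then show ?thesis
    by (simp add: simpson_vector_def)
qed

lemma vertex_sum_inner_tri_vector:
  "(\<Sum>i\<in>UNIV. q (tri l i) \<bullet> tri_vector tri q l) = 3 * (q (tri l 1) \<bullet> (q (tri l 2) \<times> q (tri l 3)))"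
proof -
  have "(x + y + z) \<bullet> (x \<times> y + y \<times> z + z \<times> x) = 3 * (x \<bullet> (y \<times> z))" for x y z :: "real^3"
    by (simp add: inner_vec_def sum_3 cross3_def algebra_simps)
  then show ?thesis
    by (simp add: tri_vector_cyclic sum_3 flip: inner_add_left)
qed

text \<open>The right-hand side is Simpson's rule for the derivative of the triple product along the
  segment: \<open>rate\<close> is homogeneous of degree two, so doubling the midpoint supplies the
  weight \<open>4\<close>.\<close>

lemma triple_product_increment:
  fixes x y z x' y' z' :: "real^3"
  defines "rate \<equiv> \<lambda>u v w. (x' - x) \<bullet> (v \<times> w) + (y' - y) \<bullet> (w \<times> u) + (z' - z) \<bullet> (u \<times> v)"
  shows "6 * (x' \<bullet> (y' \<times> z') - x \<bullet> (y \<times> z))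
     = rate x y z + rate (x + x') (y + y') (z + z') + rate x' y' z'"
  unfolding rate_def by (simp add: inner_vec_def sum_3 cross3_def algebra_simps)

text \<open>Both sides are three times the increment of \<open>det (q\<^sub>1, q\<^sub>2, q\<^sub>3)\<close>: the first sum on the
  right replaces each opposite edge in \<open>rate\<close> by the whole triangle vector, and \<open>edge_flux\<close>
  removes the excess.\<close>

lemma triangle_volume_increment:
  fixes q q' :: "'v \<Rightarrow> real^3"
  shows "(\<Sum>i\<in>UNIV. q' (tri l i) \<bullet> tri_vector tri q' l) - (\<Sum>i\<in>UNIV. q (tri l i) \<bullet> tri_vector tri q l)
     = (1/2) * ((\<Sum>i\<in>UNIV. (q' (tri l i) - q (tri l i)) \<bullet> simpson_vector tri q q' l)
                - (\<Sum>i\<in>UNIV. edge_flux q q' (tri l i) (tri l (i + 1))))"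
proof -
  define x y z x' y' z' where vertices:
    "x = q (tri l 1)" "y = q (tri l 2)" "z = q (tri l 3)"
    "x' = q' (tri l 1)" "y' = q' (tri l 2)" "z' = q' (tri l 3)"
  define a b c where "a = x' - x" and "b = y' - y" and "c = z' - z"
  note defs = vertices a_def b_def c_def
  define T where "T u v w = u \<times> v + v \<times> w + w \<times> u" for u v w :: "real^3"
  define rate where "rate u v w = a \<bullet> (v \<times> w) + b \<bullet> (w \<times> u) + c \<bullet> (u \<times> v)" for u v w
  define edges where "edges u v w = (a + b) \<bullet> (u \<times> v) + (b + c) \<bullet> (v \<times> w) + (c + a) \<bullet> (w \<times> u)" for u v w
  have rate: "rate u v w = (a + b + c) \<bullet> T u v w - edges u v w" for u v w
    by (simp add: rate_def T_def edges_def inner_add_left inner_add_right)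
  have succ: "(1::3) + 1 = 2" "(2::3) + 1 = 3" "(3::3) + 1 = 1"
    by simp_all
  have simpson: "(\<Sum>i\<in>UNIV. (q' (tri l i) - q (tri l i)) \<bullet> simpson_vector tri q q' l)
      = (a + b + c) \<bullet> T x y z + (a + b + c) \<bullet> T (x + x') (y + y') (z + z') + (a + b + c) \<bullet> T x' y' z'"
    by (simp only: sum_3 simpson_vector_eq tri_vector_cyclic T_def defs inner_add_left inner_add_right)
  have flux: "(\<Sum>i\<in>UNIV. edge_flux q q' (tri l i) (tri l (i + 1)))
      = edges x y z + edges (x + x') (y + y') (z + z') + edges x' y' z'"
    by (simp only: sum_3 succ edge_flux_def edges_def defs) (simp add: inner_add_right)
  have "6 * (x' \<bullet> (y' \<times> z') - x \<bullet> (y \<times> z))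
     = rate x y z + rate (x + x') (y + y') (z + z') + rate x' y' z'"
    unfolding rate_def a_def b_def c_def by (rule triple_product_increment)
  then show ?thesis
    unfolding simpson flux vertex_sum_inner_tri_vector vertices[symmetric] by (simp add: rate)
qed

lemma area_times_normal: "tri_area tri q l * (x \<bullet> tri_normal tri q l) = (1/2) * (x \<bullet> tri_vector tri q l)"
  by (cases "tri_vector tri q l = 0") (simp_all add: tri_area_def tri_normal_def)

lemma volume_increment:
  fixes tri :: "('l::finite, 'v) connectivity"
  assumes "closed_oriented tri"
  shows "enclosed_volume tri q' - enclosed_volume tri q
     = (1/36) * (\<Sum>l\<in>UNIV. \<Sum>i\<in>UNIV. (q' (tri l i) - q (tri l i)) \<bullet> simpson_vector tri q q' l)"
proof -
  have vol: "enclosed_volume tri p = (1/18) * (\<Sum>l\<in>UNIV. \<Sum>i\<in>UNIV. p (tri l i) \<bullet> tri_vector tri p l)" for p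
    by (simp add: enclosed_volume_def area_times_normal flip: sum_divide_distrib)
  have "enclosed_volume tri q' - enclosed_volume tri q
      = (1/18) * (\<Sum>l\<in>UNIV. (\<Sum>i\<in>UNIV. q' (tri l i) \<bullet> tri_vector tri q' l)
                          - (\<Sum>i\<in>UNIV. q (tri l i) \<bullet> tri_vector tri q l))"
    by (simp add: vol sum_subtractf right_diff_distrib)
  also have "\<dots> = (1/36) * ((\<Sum>l\<in>UNIV. \<Sum>i\<in>UNIV. (q' (tri l i) - q (tri l i)) \<bullet> simpson_vector tri q q' l)
                - (\<Sum>l\<in>UNIV. \<Sum>i\<in>UNIV. edge_flux q q' (tri l i) (tri l (i + 1))))"
    unfolding triangle_volume_increment sum_distrib_left[symmetric] sum_subtractf by simp
  also have "(\<Sum>l\<in>UNIV. \<Sum>i\<in>UNIV. edge_flux q q' (tri l i) (tri l (i + 1))) = 0"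
    using assms edge_flux_antisym by (rule sum_directed_edges_antisym)
  finally show ?thesis
    by simp
qed

section \<open>One-sided limits at the vertices\<close>

lemma vertex_in_closed_tri: "q (tri l i) \<in> closed_tri tri q l"
  unfolding closed_tri_def using exhaust_3[of i] by (auto intro: hull_inc)

lemma closed_tri_subset_surface: "closed_tri tri q l \<subseteq> surface tri q"
  by (auto simp: surface_def)

lemma open_tri_subset_closed_tri: "open_tri tri q l \<subseteq> closed_tri tri q l"
  unfolding open_tri_def by (rule rel_interior_subset)

lemma vertex_islimpt_open_tri:
  assumes "tri_vector tri q l \<noteq> 0"
  shows "q (tri l i) islimpt open_tri tri q l"
proof -
  have "convex (closed_tri tri q l)" "compact (closed_tri tri q l)"
    by (simp_all add: closed_tri_def finite_imp_compact_convex_hull)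
  then have closure: "closure (open_tri tri q l) = closed_tri tri q l"
    by (simp add: open_tri_def convex_closure_rel_interior compact_imp_closed)
  have "q (tri l 1) \<noteq> q (tri l 2)"
    using assms by (auto simp: tri_vector_def)
  then have "\<nexists>x. closed_tri tri q l = {x}"
    using vertex_in_closed_tri[of q tri l] by (metis singletonD)
  then have "q (tri l i) islimpt closed_tri tri q l"
    using \<open>convex (closed_tri tri q l)\<close>
    by (intro connected_imp_perfect vertex_in_closed_tri convex_connected) blast+
  then show ?thesis
    unfolding closure[symmetric] by (simp add: limpt_of_closure)
qed

text \<open>Nondegeneracy makes the filter nontrivial, without which the limit would be arbitrary.\<close>

lemma vertex_limit_eqI:
  assumes "tri_vector tri q l \<noteq> 0"
    and "(f \<longlongrightarrow> c) (at (q (tri l i)) within open_tri tri q l)"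
  shows "vertex_limit tri q f l i = c"
  unfolding vertex_limit_def using assms
  by (intro tendsto_Lim) (simp_all add: trivial_limit_within vertex_islimpt_open_tri)

lemma vertex_tendsto:
  assumes "continuous_on (surface tri q) f"
  shows "(f \<longlongrightarrow> f (q (tri l i))) (at (q (tri l i)) within open_tri tri q l)"
proof (rule tendsto_within_subset)
  show "(f \<longlongrightarrow> f (q (tri l i))) (at (q (tri l i)) within surface tri q)"
    using assms vertex_in_closed_tri closed_tri_subset_surface
    by (meson continuous_on_def subsetD)
  show "open_tri tri q l \<subseteq> surface tri q"
    using open_tri_subset_closed_tri closed_tri_subset_surface by (rule subset_trans)
qed

lemma K_space3_continuous_on:
  assumes "f \<in> K_space3 tri q"
  shows "continuous_on (surface tri q) f"
proof -
  have "continuous_on (surface tri q) (\<lambda>x. \<chi> i. f x $ i)"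
    using assms by (intro continuous_on_vec_lambda) (simp add: K_space3_def K_space_def)
  then show ?thesis
    by simp
qed

lemma const_in_K_space: "(\<lambda>x. c) \<in> K_space tri q"
  unfolding K_space_def by (auto intro: exI[of _ "0 :: real^3"])

lemma pw_const_open_tri:
  assumes "triangulation tri q" and "x \<in> open_tri tri q l"
  shows "pw_const tri q c x = c l"
proof -
  have "(THE l'. x \<in> open_tri tri q l') = l"
    using assms unfolding triangulation_def by (intro the_equality) blast+
  then show ?thesis
    by (simp add: pw_const_def)
qed

section \<open>Conservation\<close>

text \<open>Evaluation of the first term of the scheme for a constant test function; the factor
  \<open>1/36\<close> is \<open>1/3\<close> from the lumped product, \<open>1/2\<close> from the area and \<open>1/6\<close> from the normal.\<close>

lemma lumped_displacement:
  fixes tri :: "('l::finite, 'v) connectivity"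
  assumes tri: "triangulation tri q" and chi: "chi \<in> K_space3 tri q"
    and nodal: "\<And>l i. chi (q (tri l i)) = q' (tri l i)"
  shows "lumped tri q (\<lambda>x. ((chi x - x) /\<^sub>R \<Delta>t) \<bullet> half_normal tri q q' x) (\<lambda>x. c)
     = (c / (36 * \<Delta>t)) * (\<Sum>l\<in>UNIV. \<Sum>i\<in>UNIV. (q' (tri l i) - q (tri l i)) \<bullet> simpson_vector tri q q' l)"
proof -
  have nondeg: "tri_vector tri q l \<noteq> 0" for l
    using tri by (simp add: triangulation_def)
  let ?c = "\<lambda>l. simpson_vector tri q q' l /\<^sub>R (6 * norm (tri_vector tri q l))"
  have half: "half_normal tri q q' x = ?c l" if "x \<in> open_tri tri q l" for x l
    unfolding half_normal_def simpson_vector_def by (rule pw_const_open_tri[OF tri that])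
  have lim: "vertex_limit tri q (\<lambda>x. ((chi x - x) /\<^sub>R \<Delta>t) \<bullet> half_normal tri q q' x) l i
      = ((q' (tri l i) - q (tri l i)) /\<^sub>R \<Delta>t) \<bullet> ?c l" for l i
  proof (rule vertex_limit_eqI[OF nondeg])
    have "continuous_on (surface tri q) (\<lambda>x. ((chi x - x) /\<^sub>R \<Delta>t) \<bullet> ?c l)"
      using K_space3_continuous_on[OF chi] by (intro continuous_intros)
    from vertex_tendsto[OF this, of l i]
    have "((\<lambda>x. ((chi x - x) /\<^sub>R \<Delta>t) \<bullet> ?c l) \<longlongrightarrow> ((q' (tri l i) - q (tri l i)) /\<^sub>R \<Delta>t) \<bullet> ?c l)
        (at (q (tri l i)) within open_tri tri q l)"
      by (simp add: nodal)
    then show "((\<lambda>x. ((chi x - x) /\<^sub>R \<Delta>t) \<bullet> half_normal tri q q' x)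
        \<longlongrightarrow> ((q' (tri l i) - q (tri l i)) /\<^sub>R \<Delta>t) \<bullet> ?c l)
        (at (q (tri l i)) within open_tri tri q l)"
      by (rule Lim_transform_within[OF _ zero_less_one]) (simp add: half)
  qed
  have const: "vertex_limit tri q (\<lambda>x. c) l i = c" for l i
    by (rule vertex_limit_eqI[OF nondeg]) simp
  have "tri_area tri q l * ((((q' (tri l i) - q (tri l i)) /\<^sub>R \<Delta>t) \<bullet> ?c l) \<bullet> c)
      = (c / (12 * \<Delta>t)) * ((q' (tri l i) - q (tri l i)) \<bullet> simpson_vector tri q q' l)" for l i
    using nondeg[of l] by (simp add: tri_area_def) (simp add: field_simps)
  then show ?thesis
    unfolding lumped_def lim const by (simp only: sum_distrib_left[symmetric])
qed

lemma surf_grad_const_eq: "surf_grad tri q (\<lambda>x. c) = surf_grad tri q (\<lambda>x. d)"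
proof -
  have "((\<lambda>x. c) has_derivative D) F \<longleftrightarrow> ((\<lambda>x. d) has_derivative D) F"
    for D :: "real^3 \<Rightarrow> real" and F
    by (simp add: has_derivative_def)
  then show ?thesis
    by (simp add: surf_grad_def fun_eq_iff)
qed

theorem mainTheorem1:
  fixes tri :: "('l::finite, 'v::finite) connectivity"
    and q0 :: "'v \<Rightarrow> real^3"
    and \<Delta>t :: real
    and \<gamma> s :: "real^3 \<Rightarrow> real"
    and X chi :: "nat \<Rightarrow> real^3 \<Rightarrow> real^3"
    and \<mu> \<kappa> :: "nat \<Rightarrow> real^3 \<Rightarrow> real"
    and m :: nat
  assumes "\<Delta>t > 0"
    and "anisotropy \<gamma> s"
    and "discrete_surface tri q0"
    and "\<And>k. X 0 (q0 k) = q0 k"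
    and "X m \<in> K_space3 tri q0"
    and "discrete_surface tri (\<lambda>k. X m (q0 k))"
    and "discrete_surface tri (\<lambda>k. X (Suc m) (q0 k))"
    and "VC_MD_BDF1_step \<Delta>t \<gamma> s tri q0 (X m) (X (Suc m)) (chi (Suc m)) (\<mu> (Suc m)) (\<kappa> (Suc m))"
  shows "enclosed_volume tri (\<lambda>k. X (Suc m) (q0 k)) = enclosed_volume tri (\<lambda>k. X m (q0 k))"
proof -
  define q where "q = (\<lambda>k. X m (q0 k))"
  define q' where "q' = (\<lambda>k. X (Suc m) (q0 k))"
  let ?D = "\<lambda>x. ((chi (Suc m) x - x) /\<^sub>R \<Delta>t) \<bullet> half_normal tri q q' x"
  let ?G = "lumped tri q (surf_grad tri q (\<mu> (Suc m)))"
  have chi: "chi (Suc m) \<in> K_space3 tri q"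
    and eq: "\<And>\<phi>. \<phi> \<in> K_space tri q \<Longrightarrow> lumped tri q ?D \<phi> + ?G (surf_grad tri q \<phi>) = 0"
    and upd: "\<And>x. x \<in> surface tri q0 \<Longrightarrow> X (Suc m) x = chi (Suc m) (X m x)"
    using assms(8) unfolding VC_MD_BDF1_step_def Let_def q_def q'_def by blast+
  have tri: "triangulation tri q" and closed: "closed_oriented tri"
    using assms(6) unfolding discrete_surface_def q_def by blast+
  have nodal: "chi (Suc m) (q (tri l i)) = q' (tri l i)" for l i
    using upd[of "q0 (tri l i)"] vertex_in_closed_tri[of q0 tri l i] closed_tri_subset_surface[of tri q0 l]
    unfolding q_def q'_def by auto
  let ?S = "\<Sum>l\<in>UNIV. \<Sum>i\<in>UNIV. (q' (tri l i) - q (tri l i)) \<bullet> simpson_vector tri q q' l"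
  have lumped: "lumped tri q ?D (\<lambda>x. c) = (c / (36 * \<Delta>t)) * ?S" for c
    by (rule lumped_displacement[OF tri chi nodal])
  \<comment> \<open>The constants \<open>1\<close> and \<open>0\<close> have the same gradient, so the gradient term cancels
    without being evaluated.\<close>
  have "lumped tri q ?D (\<lambda>x. 1) = lumped tri q ?D (\<lambda>x. 0)"
    using eq[OF const_in_K_space, of 1] eq[OF const_in_K_space, of 0]
      surf_grad_const_eq[of tri q 1 0] by simp
  then have "?S = 0"
    unfolding lumped using \<open>\<Delta>t > 0\<close> by simp
  then show ?thesis
    using volume_increment[OF closed, of q' q] by (simp add: q_def q'_def)
qed

end
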